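(* Let $k$ be a field of characteristic not $2$ and suppose that $\imath=\sqrt{-1}\in k$. If $A$ is a $\mathbb{Z}_2^n$-graded (associative, unital) $k$-algebra which is braided-commutative with respect to $\Psi$ of the form $\Psi(a\otimes b)=\Psi_{\rm super}(a\otimes b)(-1)^{|a|\cdot|b|}$, then the super tensor product $A\,\underline{\otimes}\,A$ acts on $A$ by $$(a\otimes b).c=abc\,(-1)^{|b|\cdot|c|}\,\imath^{\rho(b)}$$ for homogeneous $a,b,c\in A$, where $\rho(b)\equiv\sum_{i=1}^n|b|_i=|b|\cdot|b|$ is viewed in $\mathbb{Z}$ rather than in $\mathbb{Z}_2$. Moreover, the action is a $\mathbb{Z}_2^n$-graded and $\mathbb{Z}_2$-graded one.
   Context: For homogeneous $a\in A$, $|a|=(|a|_1,\dots,|a|_n)\in\mathbb{Z}_2^n$ denotes its degree (components represented by $0,1$), $\rho(a)=\sum_i|a|_i$ gives mod $2$ the induced $\mathbb{Z}_2$-grading, and $|a|\cdot|b|=\sum_i|a|_i|b|_i$ is the dot product. $\Psi_{\rm super}(a\otimes b)=(-1)^{\rho(a)\rho(b)}b\otimes a$ is the super transposition. Braided-commutative means that the product $\mu$ of $A$ satisfies $\mu\circ\Psi=\mu$, i.e. $ab=(-1)^{\rho(a)\rho(b)+|a|\cdot|b|}ba$ for homogeneous $a,b$. The super tensor product algebra $A\,\underline{\otimes}\,A$ has product $(a\otimes b)(a'\otimes b')=(-1)^{\rho(b)\rho(a')}aa'\otimes bb'$ and total grading $|a\otimes b|=|a|+|b|$. A graded action is one for which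 $h.c$ has degree $|h|+|c|$ for homogeneous $h$, $c$. *)

theory Defs
  imports "HOL.Vector_Spaces" "HOL-Algebra.Module" "HOL-Library.Poly_Mapping" "HOL-Library.Z2"
    "HOL-Library.Function_Algebras"
begin

section \<open>Algebras graded by a power of the group of order two\<close>

text \<open>
  An element of $\mathbb{Z}_2^n$ is a sequence of bits supported on the indices below \<open>n\<close>
  (so \<open>n = 0\<close> is allowed); addition of degrees is the pointwise one.
\<close>

definition Z2n :: "nat \<Rightarrow> (nat \<Rightarrow> bit) set" where
  "Z2n n = {d. \<forall>i\<ge>n. d i = 0}"

text \<open>
  Both of the following are natural numbers, computed from the representatives 0 and 1 of the
  components; they are not reduced modulo 2.
\<close>

definition rho :: "nat \<Rightarrow> (nat \<Rightarrow> bit) \<Rightarrow> nat" where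
  "rho n d = (\<Sum>i<n. of_bit (d i))"

definition dotp :: "nat \<Rightarrow> (nat \<Rightarrow> bit) \<Rightarrow> (nat \<Rightarrow> bit) \<Rightarrow> nat" where
  "dotp n d e = (\<Sum>i<n. of_bit (d i) * of_bit (e i))"

definition homogeneous_decomposition ::
    "nat \<Rightarrow> ((nat \<Rightarrow> bit) \<Rightarrow> 'a set) \<Rightarrow> 'a::comm_monoid_add \<Rightarrow> ((nat \<Rightarrow> bit) \<Rightarrow> 'a) \<Rightarrow> bool" where
  "homogeneous_decomposition n G a x \<longleftrightarrow>
     (\<forall>d\<in>Z2n n. x d \<in> G d) \<and> (\<forall>d. d \<notin> Z2n n \<longrightarrow> x d = 0) \<and> a = (\<Sum>d\<in>Z2n n. x d)"

definition component ::
    "nat \<Rightarrow> ((nat \<Rightarrow> bit) \<Rightarrow> 'a set) \<Rightarrow> (nat \<Rightarrow> bit) \<Rightarrow> 'a::comm_monoid_add \<Rightarrow> 'a" where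
  "component n G d a = (THE x. homogeneous_decomposition n G a x) d"

text \<open>
  The sort \<open>{ring, monoid_mult}\<close> is that of associative unital rings without the
  axiom \<open>0 \<noteq> 1\<close> of \<open>ring_1\<close>, so the zero algebra is included.
\<close>

locale Z2n_graded_algebra = Vector_Spaces.vector_space scale
  for scale :: "'k::field \<Rightarrow> 'a::{ring,monoid_mult} \<Rightarrow> 'a" +
  fixes n :: nat and G :: "(nat \<Rightarrow> bit) \<Rightarrow> 'a set"
  assumes scale_mult_left: "scale r a * b = scale r (a * b)"
    and scale_mult_right: "a * scale r b = scale r (a * b)"
    and subspace_grade: "d \<in> Z2n n \<Longrightarrow> subspace (G d)"
    and ex1_decomposition: "\<exists>!x. homogeneous_decomposition n G a x"
    and one_grade: "1 \<in> G 0"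
    and mult_grade: "\<lbrakk>d \<in> Z2n n; e \<in> Z2n n; a \<in> G d; b \<in> G e\<rbrakk> \<Longrightarrow> a * b \<in> G (d + e)"

text \<open>
  The span of the homogeneous elements with degree in \<open>D\<close>; the induced $\mathbb{Z}_2$-grading
  has the parts \<open>grade_part scale G {d \<in> Z2n n. of_nat (rho n d) = p}\<close> for \<open>p :: bit\<close>.
\<close>

definition grade_part ::
    "('k::field \<Rightarrow> 'a::ab_group_add \<Rightarrow> 'a) \<Rightarrow> ((nat \<Rightarrow> bit) \<Rightarrow> 'a set) \<Rightarrow> (nat \<Rightarrow> bit) set \<Rightarrow> 'a set" where
  "grade_part scale G D = Modules.module.span scale (\<Union>d\<in>D. G d)"


section \<open>The tensor product of two vector spaces\<close>

text \<open>
  The tensor product is the free vector space on the set of pairs modulo the subspace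
  generated by the bilinearity relations; its elements are cosets.
\<close>

type_synonym ('k, 'a, 'b) tensor = "('a \<times> 'b \<Rightarrow>\<^sub>0 'k) set"

definition free_scale :: "'k::field \<Rightarrow> ('p \<Rightarrow>\<^sub>0 'k) \<Rightarrow> ('p \<Rightarrow>\<^sub>0 'k)" where
  "free_scale r f = Poly_Mapping.map ((*) r) f"

definition bilinearity_relations ::
    "('k::field \<Rightarrow> 'a::ab_group_add \<Rightarrow> 'a) \<Rightarrow> ('k \<Rightarrow> 'b::ab_group_add \<Rightarrow> 'b) \<Rightarrow> ('a \<times> 'b \<Rightarrow>\<^sub>0 'k) set" where
  "bilinearity_relations s1 s2 =
     {Poly_Mapping.single (a + a', b) 1 - Poly_Mapping.single (a, b) 1
        - Poly_Mapping.single (a', b) 1 | a a' b. True} \<union>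
     {Poly_Mapping.single (a, b + b') 1 - Poly_Mapping.single (a, b) 1
        - Poly_Mapping.single (a, b') 1 | a b b'. True} \<union>
     {Poly_Mapping.single (s1 r a, b) 1 - free_scale r (Poly_Mapping.single (a, b) 1) | r a b. True} \<union>
     {Poly_Mapping.single (a, s2 r b) 1 - free_scale r (Poly_Mapping.single (a, b) 1) | r a b. True}"

definition tensor_kernel ::
    "('k::field \<Rightarrow> 'a::ab_group_add \<Rightarrow> 'a) \<Rightarrow> ('k \<Rightarrow> 'b::ab_group_add \<Rightarrow> 'b) \<Rightarrow> ('a \<times> 'b \<Rightarrow>\<^sub>0 'k) set" where
  "tensor_kernel s1 s2 = Modules.module.span free_scale (bilinearity_relations s1 s2)"

definition tensor_class ::
    "('k::field \<Rightarrow> 'a::ab_group_add \<Rightarrow> 'a) \<Rightarrow> ('k \<Rightarrow> 'b::ab_group_add \<Rightarrow> 'b)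
      \<Rightarrow> ('a \<times> 'b \<Rightarrow>\<^sub>0 'k) \<Rightarrow> ('k, 'a, 'b) tensor" where
  "tensor_class s1 s2 f = {g. g - f \<in> tensor_kernel s1 s2}"

definition pure_tensor ::
    "('k::field \<Rightarrow> 'a::ab_group_add \<Rightarrow> 'a) \<Rightarrow> ('k \<Rightarrow> 'b::ab_group_add \<Rightarrow> 'b)
      \<Rightarrow> 'a \<Rightarrow> 'b \<Rightarrow> ('k, 'a, 'b) tensor" where
  "pure_tensor s1 s2 a b = tensor_class s1 s2 (Poly_Mapping.single (a, b) 1)"


section \<open>The super tensor product of a graded algebra with itself\<close>

text \<open>
  The product $(a\otimes b)(a'\otimes b') = (-1)^{\rho(b)\rho(a')}\,aa'\otimes bb'$ is prescribed
  for homogeneous \<open>b\<close> and \<open>a'\<close>; in general both are split into their homogeneous components.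
\<close>

definition super_mult_gen ::
    "nat \<Rightarrow> ((nat \<Rightarrow> bit) \<Rightarrow> 'a::{ring,monoid_mult} set) \<Rightarrow> 'a \<times> 'a \<Rightarrow> 'a \<times> 'a \<Rightarrow> ('a \<times> 'a \<Rightarrow>\<^sub>0 'k::field)" where
  "super_mult_gen n G p q =
     (\<Sum>d\<in>Z2n n. \<Sum>e\<in>Z2n n. free_scale ((-1) ^ (rho n d * rho n e))
        (Poly_Mapping.single (fst p * component n G e (fst q), component n G d (snd p) * snd q) 1))"

definition super_mult ::
    "nat \<Rightarrow> ((nat \<Rightarrow> bit) \<Rightarrow> 'a::{ring,monoid_mult} set)
      \<Rightarrow> ('a \<times> 'a \<Rightarrow>\<^sub>0 'k::field) \<Rightarrow> ('a \<times> 'a \<Rightarrow>\<^sub>0 'k) \<Rightarrow> ('a \<times> 'a \<Rightarrow>\<^sub>0 'k)" where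
  "super_mult n G f g =
     (\<Sum>p\<in>Poly_Mapping.keys f. \<Sum>q\<in>Poly_Mapping.keys g.
        free_scale (Poly_Mapping.lookup f p * Poly_Mapping.lookup g q) (super_mult_gen n G p q))"

text \<open>
  The operations on cosets are computed on representatives; the unions are over equal cosets,
  as the lemmas below show.
\<close>

definition super_tensor ::
    "('k::field \<Rightarrow> 'a::{ring,monoid_mult} \<Rightarrow> 'a) \<Rightarrow> nat \<Rightarrow> ((nat \<Rightarrow> bit) \<Rightarrow> 'a set)
      \<Rightarrow> ('k, ('k, 'a, 'a) tensor) module" where
  "super_tensor scale n G =
     \<lparr>carrier = range (tensor_class scale scale),
      mult = (\<lambda>X Y. \<Union>f\<in>X. \<Union>g\<in>Y. tensor_class scale scale (super_mult n G f g)),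
      one = pure_tensor scale scale 1 1,
      zero = tensor_class scale scale 0,
      add = (\<lambda>X Y. \<Union>f\<in>X. \<Union>g\<in>Y. tensor_class scale scale (f + g)),
      smult = (\<lambda>r X. \<Union>f\<in>X. tensor_class scale scale (free_scale r f))\<rparr>"

text \<open>
  The span of the \<open>a \<otimes> b\<close> with \<open>a\<close>, \<open>b\<close> homogeneous and total degree \<open>|a| + |b|\<close> in \<open>D\<close>.
\<close>

definition tensor_part ::
    "('k::field \<Rightarrow> 'a::ab_group_add \<Rightarrow> 'a) \<Rightarrow> nat \<Rightarrow> ((nat \<Rightarrow> bit) \<Rightarrow> 'a set) \<Rightarrow> (nat \<Rightarrow> bit) set
      \<Rightarrow> ('k, 'a, 'a) tensor set" where
  "tensor_part scale n G D =
     tensor_class scale scale ` Modules.module.span free_scale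
       {Poly_Mapping.single (a, b) 1 | a b d e.
          d \<in> Z2n n \<and> e \<in> Z2n n \<and> d + e \<in> D \<and> a \<in> G d \<and> b \<in> G e}"


section \<open>Actions\<close>

text \<open>
  A left action of the algebra \<open>T\<close>: a bilinear map \<open>T \<times> A \<rightarrow> A\<close> making \<open>A\<close> a unital
  left \<open>T\<close>-module.
\<close>

definition algebra_action ::
    "('k::field, 't, 'm) module_scheme \<Rightarrow> ('k \<Rightarrow> 'a::ab_group_add \<Rightarrow> 'a) \<Rightarrow> ('t \<Rightarrow> 'a \<Rightarrow> 'a) \<Rightarrow> bool" where
  "algebra_action T scale act \<longleftrightarrow>
     (\<forall>x\<in>carrier T. Vector_Spaces.linear scale scale (act x)) \<and>
     (\<forall>x\<in>carrier T. \<forall>y\<in>carrier T. \<forall>c. act (x \<oplus>\<^bsub>T\<^esub> y) c = act x c + act y c) \<and>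
     (\<forall>r. \<forall>x\<in>carrier T. \<forall>c. act (r \<odot>\<^bsub>T\<^esub> x) c = scale r (act x c)) \<and>
     (\<forall>x\<in>carrier T. \<forall>y\<in>carrier T. \<forall>c. act (x \<otimes>\<^bsub>T\<^esub> y) c = act x (act y c)) \<and>
     (\<forall>c. act \<one>\<^bsub>T\<^esub> c = c)"


section \<open>The super tensor product is an algebra\<close>

lemma UN_eq_const: "x \<in> X \<Longrightarrow> (\<And>y. y \<in> X \<Longrightarrow> F y = C) \<Longrightarrow> (\<Union>y\<in>X. F y) = C"
  by blast

lemma Z2n_add: "d \<in> Z2n n \<Longrightarrow> e \<in> Z2n n \<Longrightarrow> d + e \<in> Z2n n"
  by (simp add: Z2n_def)

lemma Z2n_zero: "0 \<in> Z2n n"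
  by (simp add: Z2n_def)

lemma finite_Z2n: "finite (Z2n n)"
proof (rule finite_subset)
  show "Z2n n \<subseteq> (\<lambda>S i. of_bool (i \<in> S)) ` Pow {..<n}"
  proof
    fix d assume d: "d \<in> Z2n n"
    have "d = (\<lambda>i. of_bool (i \<in> {i. i < n \<and> d i = 1}))"
    proof
      fix i show "d i = of_bool (i \<in> {i. i < n \<and> d i = 1})"
        using d by (cases "d i"; cases "i < n") (auto simp: Z2n_def)
    qed
    moreover have "{i. i < n \<and> d i = 1} \<in> Pow {..<n}" by auto
    ultimately show "d \<in> (\<lambda>S i. of_bool (i \<in> S)) ` Pow {..<n}" by (rule image_eqI)
  qed
qed simp

lemma rho_eq_dotp: "rho n d = dotp n d d"
  by (simp add: rho_def dotp_def)

lemma even_rho_add: "even (rho n (d + e)) \<longleftrightarrow> even (rho n d + rho n e)"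
proof (induction n)
  case (Suc n)
  then show ?case
    by (cases "d n"; cases "e n") (auto simp: rho_def)
qed (simp add: rho_def)

lemma sign_add_left:
  "(-1) ^ (rho n (d + e) * m) = (-1) ^ (rho n d * m) * ((-1) ^ (rho n e * m) :: 'k::field)"
  using even_rho_add[of n d e] by (auto simp: minus_one_power_iff)

lemma sign_add_right:
  "(-1) ^ (m * rho n (d + e)) = (-1) ^ (m * rho n d) * ((-1) ^ (m * rho n e) :: 'k::field)"
  using even_rho_add[of n d e] by (auto simp: minus_one_power_iff)

lemma rho_zero: "rho n 0 = 0"
  by (simp add: rho_def)

lemma lookup_free_scale [simp]:
  "Poly_Mapping.lookup (free_scale r f) p = r * Poly_Mapping.lookup f p"
  by (simp add: free_scale_def map.rep_eq when_def)

interpretation free: Vector_Spaces.vector_space free_scale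
  by unfold_locales (auto intro!: poly_mapping_eqI simp: lookup_add algebra_simps)

definition free_lin :: "('p \<Rightarrow> ('q \<Rightarrow>\<^sub>0 'k::field)) \<Rightarrow> ('p \<Rightarrow>\<^sub>0 'k) \<Rightarrow> ('q \<Rightarrow>\<^sub>0 'k)" where
  "free_lin \<phi> f = (\<Sum>p\<in>Poly_Mapping.keys f. free_scale (Poly_Mapping.lookup f p) (\<phi> p))"

lemma free_lin_superset:
  assumes "finite S" "Poly_Mapping.keys f \<subseteq> S"
  shows "free_lin \<phi> f = (\<Sum>p\<in>S. free_scale (Poly_Mapping.lookup f p) (\<phi> p))"
  unfolding free_lin_def using assms
  by (intro sum.mono_neutral_left) (auto simp: in_keys_iff)

lemma free_lin_single [simp]: "free_lin \<phi> (Poly_Mapping.single p 1) = \<phi> p"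
  by (simp add: free_lin_def)

lemma free_lin_add: "free_lin \<phi> (f + g) = free_lin \<phi> f + free_lin \<phi> g"
proof -
  let ?S = "Poly_Mapping.keys f \<union> Poly_Mapping.keys g"
  have "Poly_Mapping.keys (f + g) \<subseteq> ?S" by (rule keys_add)
  then show ?thesis
    by (simp add: free_lin_superset[of ?S] lookup_add free.scale_left_distrib sum.distrib)
qed

lemma free_lin_scale: "free_lin \<phi> (free_scale r f) = free_scale r (free_lin \<phi> f)"
proof -
  have "Poly_Mapping.keys (free_scale r f) \<subseteq> Poly_Mapping.keys f" by (auto simp: in_keys_iff)
  then show ?thesis
    by (simp add: free_lin_superset[of "Poly_Mapping.keys f"] free.scale_sum_right)
qed

lemma free_lin_diff: "free_lin \<phi> (f - g) = free_lin \<phi> f - free_lin \<phi> g"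
  using free_lin_add[of \<phi> "f - g" g] by simp

lemma free_lin_fun_diff: "free_lin (\<lambda>p. \<phi> p - \<psi> p) f = free_lin \<phi> f - free_lin \<psi> f"
  by (simp add: free_lin_def free.scale_right_diff_distrib sum_subtractf)

lemma free_lin_fun_add: "free_lin (\<lambda>p. \<phi> p + \<psi> p) f = free_lin \<phi> f + free_lin \<psi> f"
  by (simp add: free_lin_def free.scale_right_distrib sum.distrib)

lemma free_lin_fun_scale: "free_lin (\<lambda>p. free_scale r (\<phi> p)) f = free_scale r (free_lin \<phi> f)"
  by (simp add: free_lin_def free.scale_sum_right mult.commute)

lemma free_lin_in: "free.subspace S \<Longrightarrow> (\<And>p. \<phi> p \<in> S) \<Longrightarrow> free_lin \<phi> f \<in> S"
  unfolding free_lin_def by (intro free.subspace_sum free.subspace_scale) auto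

lemma free_lin_id: "free_lin (\<lambda>p. Poly_Mapping.single p 1) f = f"
  by (rule poly_mapping_eqI)
    (auto simp: free_lin_def lookup_sum lookup_single when_def in_keys_iff
      if_distrib[of "(*) _"] sum.delta' cong: if_cong)

lemma super_mult_eq: "super_mult n G f g = free_lin (\<lambda>p. free_lin (super_mult_gen n G p) g) f"
  by (simp add: super_mult_def free_lin_def free.scale_sum_right)

lemma super_mult_linear_left:
  "super_mult n G (f + f') g = super_mult n G f g + super_mult n G f' g"
  "super_mult n G (free_scale r f) g = free_scale r (super_mult n G f g)"
  "super_mult n G (f - f') g = super_mult n G f g - super_mult n G f' g"
  by (simp_all add: super_mult_eq free_lin_add free_lin_scale free_lin_diff)

lemma super_mult_linear_right:
  "super_mult n G f (g + g') = super_mult n G f g + super_mult n G f g'"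
  "super_mult n G f (free_scale r g) = free_scale r (super_mult n G f g)"
  "super_mult n G f (g - g') = super_mult n G f g - super_mult n G f g'"
  by (simp_all add: super_mult_eq free_lin_add free_lin_scale free_lin_diff
      free_lin_fun_add free_lin_fun_scale free_lin_fun_diff)

lemma super_mult_single:
  "super_mult n G (Poly_Mapping.single p 1) (Poly_Mapping.single q 1) = super_mult_gen n G p q"
  by (simp add: super_mult_eq)

context Z2n_graded_algebra
begin

abbreviation "ker \<equiv> tensor_kernel scale scale"
abbreviation "cls \<equiv> tensor_class scale scale"
abbreviation gen :: "'a \<Rightarrow> 'a \<Rightarrow> ('a \<times> 'a \<Rightarrow>\<^sub>0 'k)" where
  "gen a b \<equiv> Poly_Mapping.single (a, b) 1"
abbreviation "T \<equiv> super_tensor scale n G"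
abbreviation "hcomp \<equiv> component n G"
abbreviation smul :: "('a \<times> 'a \<Rightarrow>\<^sub>0 'k) \<Rightarrow> ('a \<times> 'a \<Rightarrow>\<^sub>0 'k) \<Rightarrow> ('a \<times> 'a \<Rightarrow>\<^sub>0 'k)" where
  "smul \<equiv> super_mult n G"

lemma decomposition_component: "homogeneous_decomposition n G a (\<lambda>d. hcomp d a)"
  using theI'[OF ex1_decomposition[of a]] by (simp add: component_def)

lemma component_eqI: "homogeneous_decomposition n G a x \<Longrightarrow> hcomp d a = x d"
  using ex1_decomposition[of a] decomposition_component[of a] by metis

lemma component_in: "d \<in> Z2n n \<Longrightarrow> hcomp d a \<in> G d"
  using decomposition_component[of a] by (simp add: homogeneous_decomposition_def)

lemma sum_component: "(\<Sum>d\<in>Z2n n. hcomp d a) = a"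
  using decomposition_component[of a] by (simp add: homogeneous_decomposition_def)

lemma component_add: "hcomp d (a + b) = hcomp d a + hcomp d b"
  using decomposition_component[of a] decomposition_component[of b]
  by (intro component_eqI)
    (auto simp: homogeneous_decomposition_def sum.distrib intro!: subspace_add[OF subspace_grade])

lemma component_scale: "hcomp d (scale r a) = scale r (hcomp d a)"
  using decomposition_component[of a]
  by (intro component_eqI)
    (auto simp: homogeneous_decomposition_def scale_sum_right[symmetric]
      intro!: subspace_scale[OF subspace_grade])

lemma component_homogeneous:
  assumes "e \<in> Z2n n" "a \<in> G e"
  shows "hcomp d a = (if d = e then a else 0)"
  by (rule component_eqI)
    (use assms in \<open>auto simp: homogeneous_decomposition_def finite_Z2n sum.delta
      intro: subspace_0[OF subspace_grade]\<close>)

lemma subspace_ker: "free.subspace ker"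
  by (simp add: tensor_kernel_def)

lemma ker_simps:
  "0 \<in> ker" "f \<in> ker \<Longrightarrow> g \<in> ker \<Longrightarrow> f + g \<in> ker" "f \<in> ker \<Longrightarrow> g \<in> ker \<Longrightarrow> f - g \<in> ker"
  "f \<in> ker \<Longrightarrow> free_scale r f \<in> ker" "f \<in> ker \<Longrightarrow> - f \<in> ker"
  by (simp_all add: subspace_ker free.subspace_0 free.subspace_add free.subspace_diff
      free.subspace_scale free.subspace_neg)

lemma ker_sum: "(\<And>i. i \<in> I \<Longrightarrow> f i \<in> ker) \<Longrightarrow> sum f I \<in> ker"
  by (rule free.subspace_sum[OF subspace_ker])

lemma gen_relations:
  "gen (a + a') b - gen a b - gen a' b \<in> ker"
  "gen a (b + b') - gen a b - gen a b' \<in> ker"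
  "gen (scale r a) b - free_scale r (gen a b) \<in> ker"
  "gen a (scale r b) - free_scale r (gen a b) \<in> ker"
  unfolding tensor_kernel_def bilinearity_relations_def by (intro free.span_base; blast)+

lemma cls_eq_iff: "cls f = cls g \<longleftrightarrow> f - g \<in> ker"
proof
  assume "cls f = cls g"
  moreover have "f \<in> cls f" by (simp add: tensor_class_def ker_simps)
  ultimately show "f - g \<in> ker" by (simp add: tensor_class_def)
next
  assume *: "f - g \<in> ker"
  have "h - g = (h - f) + (f - g)" "h - f = (h - g) - (f - g)" for h by simp_all
  then have "h - f \<in> ker \<longleftrightarrow> h - g \<in> ker" for h
    using ker_simps(2,3)[OF _ *] by metis
  then show "cls f = cls g" by (simp add: tensor_class_def)
qed

lemma mem_cls: "g \<in> cls f \<longleftrightarrow> cls g = cls f"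
  unfolding cls_eq_iff by (simp add: tensor_class_def)

lemma free_lin_ker:
  assumes "\<And>a a' b. \<phi> (a + a', b) - \<phi> (a, b) - \<phi> (a', b) \<in> ker"
    and "\<And>a b b'. \<phi> (a, b + b') - \<phi> (a, b) - \<phi> (a, b') \<in> ker"
    and "\<And>r a b. \<phi> (scale r a, b) - free_scale r (\<phi> (a, b)) \<in> ker"
    and "\<And>r a b. \<phi> (a, scale r b) - free_scale r (\<phi> (a, b)) \<in> ker"
    and "f \<in> ker"
  shows "free_lin \<phi> f \<in> ker"
  using \<open>f \<in> ker\<close>[unfolded tensor_kernel_def]
proof (induction rule: free.span_induct)
  case base
  then show ?case
    using ker_simps(1,2,4) by (auto intro!: free.subspaceI simp: free_lin_add free_lin_scale
      free_lin_def[of \<phi> 0])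
next
  case (step f)
  then show ?case
    using assms(1-4) by (auto simp: bilinearity_relations_def free_lin_diff free_lin_scale)
qed

lemma double_sum_ker:
  assumes "\<And>d e. f d e - g d e - h d e \<in> ker"
  shows "(\<Sum>d\<in>D. \<Sum>e\<in>E. free_scale (s d e) (f d e)) - (\<Sum>d\<in>D. \<Sum>e\<in>E. free_scale (s d e) (g d e))
    - (\<Sum>d\<in>D. \<Sum>e\<in>E. free_scale (s d e) (h d e)) \<in> ker"
  unfolding sum_subtractf[symmetric] free.scale_right_diff_distrib[symmetric]
  by (intro ker_sum ker_simps(4) assms)

lemma double_sum_scale_ker:
  assumes "\<And>d e. f d e - free_scale r (g d e) \<in> ker"
  shows "(\<Sum>d\<in>D. \<Sum>e\<in>E. free_scale (s d e) (f d e))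
    - free_scale r (\<Sum>d\<in>D. \<Sum>e\<in>E. free_scale (s d e) (g d e)) \<in> ker"
proof -
  have "(\<Sum>d\<in>D. \<Sum>e\<in>E. free_scale (s d e) (f d e))
      - free_scale r (\<Sum>d\<in>D. \<Sum>e\<in>E. free_scale (s d e) (g d e))
    = (\<Sum>d\<in>D. \<Sum>e\<in>E. free_scale (s d e) (f d e - free_scale r (g d e)))"
    by (simp add: sum_subtractf free.scale_right_diff_distrib free.scale_sum_right mult.commute)
  also have "\<dots> \<in> ker" by (intro ker_sum ker_simps assms)
  finally show ?thesis .
qed

lemma super_mult_gen_relations:
  "super_mult_gen n G (a + a', b) q - super_mult_gen n G (a, b) q - super_mult_gen n G (a', b) q \<in> ker"
  "super_mult_gen n G (a, b + b') q - super_mult_gen n G (a, b) q - super_mult_gen n G (a, b') q \<in> ker"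
  "super_mult_gen n G (scale r a, b) q - free_scale r (super_mult_gen n G (a, b) q) \<in> ker"
  "super_mult_gen n G (a, scale r b) q - free_scale r (super_mult_gen n G (a, b) q) \<in> ker"
  "super_mult_gen n G p (a + a', b) - super_mult_gen n G p (a, b) - super_mult_gen n G p (a', b) \<in> ker"
  "super_mult_gen n G p (a, b + b') - super_mult_gen n G p (a, b) - super_mult_gen n G p (a, b') \<in> ker"
  "super_mult_gen n G p (scale r a, b) - free_scale r (super_mult_gen n G p (a, b)) \<in> ker"
  "super_mult_gen n G p (a, scale r b) - free_scale r (super_mult_gen n G p (a, b)) \<in> ker"
  unfolding super_mult_gen_def
  by (intro double_sum_ker double_sum_scale_ker;
      simp add: component_add component_scale distrib_left distrib_right
        scale_mult_left scale_mult_right gen_relations)+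

lemma super_mult_ker_left: "f \<in> ker \<Longrightarrow> smul f g \<in> ker"
  unfolding super_mult_eq
  by (rule free_lin_ker; (simp flip: free_lin_fun_diff free_lin_fun_scale)?;
      (rule free_lin_in[OF subspace_ker] super_mult_gen_relations)+)

lemma super_mult_ker_right: "g \<in> ker \<Longrightarrow> smul f g \<in> ker"
  unfolding super_mult_eq
  by (rule free_lin_in[OF subspace_ker], rule free_lin_ker) (rule super_mult_gen_relations | assumption)+

lemma super_mult_cong:
  assumes "cls f = cls f'" "cls g = cls g'"
  shows "cls (smul f g) = cls (smul f' g')"
proof -
  have "smul f g - smul f' g' = smul (f - f') g + smul f' (g - g')"
    by (simp add: super_mult_linear_left super_mult_linear_right)
  then show ?thesis
    using assms by (simp add: cls_eq_iff ker_simps super_mult_ker_left super_mult_ker_right)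
qed

lemma cls_add_cong:
  assumes "cls f = cls f'" "cls g = cls g'"
  shows "cls (f + g) = cls (f' + g')"
proof -
  have "(f + g) - (f' + g') = (f - f') + (g - g')" by simp
  with assms show ?thesis by (simp only: cls_eq_iff ker_simps)
qed

lemma cls_scale_cong: "cls f = cls f' \<Longrightarrow> cls (free_scale r f) = cls (free_scale r f')"
  by (simp add: cls_eq_iff ker_simps flip: free.scale_right_diff_distrib)

lemma carrier_T: "carrier T = range cls"
  by (simp add: super_tensor_def)

lemma zero_T: "\<zero>\<^bsub>T\<^esub> = cls 0"
  by (simp add: super_tensor_def)

lemma one_T: "\<one>\<^bsub>T\<^esub> = cls (gen 1 1)"
  by (simp add: super_tensor_def pure_tensor_def)

lemma add_T: "cls f \<oplus>\<^bsub>T\<^esub> cls g = cls (f + g)"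
proof -
  have "(\<Union>f'\<in>cls f. \<Union>g'\<in>cls g. cls (f' + g')) = cls (f + g)"
    by (rule UN_eq_const[of f], simp add: mem_cls, rule UN_eq_const[of g], simp add: mem_cls,
        rule cls_add_cong) (simp_all only: mem_cls)
  then show ?thesis by (simp add: super_tensor_def)
qed

lemma mult_T: "cls f \<otimes>\<^bsub>T\<^esub> cls g = cls (smul f g)"
proof -
  have "(\<Union>f'\<in>cls f. \<Union>g'\<in>cls g. cls (smul f' g')) = cls (smul f g)"
    by (rule UN_eq_const[of f], simp add: mem_cls, rule UN_eq_const[of g], simp add: mem_cls,
        rule super_mult_cong) (simp_all only: mem_cls)
  then show ?thesis by (simp add: super_tensor_def)
qed

lemma smult_T: "r \<odot>\<^bsub>T\<^esub> cls f = cls (free_scale r f)"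
proof -
  have "(\<Union>f'\<in>cls f. cls (free_scale r f')) = cls (free_scale r f)"
    by (rule UN_eq_const[of f], simp add: mem_cls, rule cls_scale_cong) (simp only: mem_cls)
  then show ?thesis by (simp add: super_tensor_def)
qed

lemma gen_zero: "gen 0 b \<in> ker" "gen a 0 \<in> ker"
  using gen_relations(3)[of 0 0 b] gen_relations(4)[of a 0 0] by simp_all

lemma super_mult_homogeneous:
  assumes "d \<in> Z2n n" "e \<in> Z2n n" "b \<in> G d" "a' \<in> G e"
  shows "cls (smul (gen a b) (gen a' b'))
    = cls (free_scale ((-1) ^ (rho n d * rho n e)) (gen (a * a') (b * b')))"
proof -
  let ?t = "\<lambda>d' e'. free_scale ((-1) ^ (rho n d' * rho n e')) (gen (a * hcomp e' a') (hcomp d' b * b'))"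
  let ?u = "?t d e"
  have "smul (gen a b) (gen a' b') = (\<Sum>x\<in>Z2n n \<times> Z2n n. case x of (d', e') \<Rightarrow> ?t d' e')"
    by (simp add: super_mult_single super_mult_gen_def sum.cartesian_product)
  also have "\<dots> = ?u + (\<Sum>x\<in>Z2n n \<times> Z2n n - {(d, e)}. case x of (d', e') \<Rightarrow> ?t d' e')"
    using assms by (subst sum.remove[of _ "(d, e)"]) (auto simp: finite_Z2n)
  finally have "smul (gen a b) (gen a' b') - ?u
      = (\<Sum>x\<in>Z2n n \<times> Z2n n - {(d, e)}. case x of (d', e') \<Rightarrow> ?t d' e')"
    by simp
  also have "\<dots> \<in> ker"
  proof (intro ker_sum)
    fix x assume x: "x \<in> Z2n n \<times> Z2n n - {(d, e)}"
    obtain d' e' where [simp]: "x = (d', e')" by (cases x)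
    have "d' \<noteq> d \<or> e' \<noteq> e" using x by auto
    then have "gen (a * hcomp e' a') (hcomp d' b * b') \<in> ker"
      using assms by (auto simp: component_homogeneous gen_zero)
    then show "(case x of (d', e') \<Rightarrow> ?t d' e') \<in> ker"
      by (simp add: ker_simps)
  qed
  finally show ?thesis
    using assms by (simp add: cls_eq_iff component_homogeneous)
qed

theorem super_tensor_mult_homogeneous:
  assumes "d \<in> Z2n n" "e \<in> Z2n n" "b \<in> G d" "a' \<in> G e"
  shows "pure_tensor scale scale a b \<otimes>\<^bsub>T\<^esub> pure_tensor scale scale a' b'
    = (-1) ^ (rho n d * rho n e) \<odot>\<^bsub>T\<^esub> pure_tensor scale scale (a * a') (b * b')"
  using super_mult_homogeneous[OF assms] by (simp add: pure_tensor_def mult_T smult_T)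

lemma gen_sum_left: "gen (\<Sum>i\<in>I. x i) b - (\<Sum>i\<in>I. gen (x i) b) \<in> ker"
proof (induction I rule: infinite_finite_induct)
  case (insert i I)
  have "gen (\<Sum>i\<in>insert i I. x i) b - (\<Sum>i\<in>insert i I. gen (x i) b)
    = (gen (x i + (\<Sum>i\<in>I. x i)) b - gen (x i) b - gen (\<Sum>i\<in>I. x i) b)
      + (gen (\<Sum>i\<in>I. x i) b - (\<Sum>i\<in>I. gen (x i) b))"
    using insert by simp
  then show ?case by (metis (no_types, lifting) insert.IH gen_relations(1) ker_simps(2))
qed (simp_all add: gen_zero)

lemma gen_sum_right: "gen a (\<Sum>i\<in>I. x i) - (\<Sum>i\<in>I. gen a (x i)) \<in> ker"
proof (induction I rule: infinite_finite_induct)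
  case (insert i I)
  have "gen a (\<Sum>i\<in>insert i I. x i) - (\<Sum>i\<in>insert i I. gen a (x i))
    = (gen a (x i + (\<Sum>i\<in>I. x i)) - gen a (x i) - gen a (\<Sum>i\<in>I. x i))
      + (gen a (\<Sum>i\<in>I. x i) - (\<Sum>i\<in>I. gen a (x i)))"
    using insert by simp
  then show ?case by (metis (no_types, lifting) insert.IH gen_relations(2) ker_simps(2))
qed (simp_all add: gen_zero)

lemma homogeneous_induct:
  fixes S :: "('a \<times> 'a \<Rightarrow>\<^sub>0 'k) set"
  assumes S: "free.subspace S" and ker: "\<And>f. f \<in> ker \<Longrightarrow> f \<in> S"
    and gen: "\<And>d e a b. d \<in> Z2n n \<Longrightarrow> e \<in> Z2n n \<Longrightarrow> a \<in> G d \<Longrightarrow> b \<in> G e \<Longrightarrow> gen a b \<in> S"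
  shows "f \<in> S"
proof -
  have "gen a b \<in> S" for a b
  proof -
    let ?s = "\<Sum>d\<in>Z2n n. \<Sum>e\<in>Z2n n. gen (hcomp d a) (hcomp e b)"
    have "gen a b - (\<Sum>d\<in>Z2n n. gen (hcomp d a) b) \<in> ker"
      using gen_sum_left[of "\<lambda>d. hcomp d a" "Z2n n" b] by (simp add: sum_component)
    moreover have "(\<Sum>d\<in>Z2n n. gen (hcomp d a) b) - ?s \<in> ker"
      unfolding sum_subtractf[symmetric]
      using gen_sum_right[of _ "\<lambda>e. hcomp e b" "Z2n n"] by (intro ker_sum) (simp add: sum_component)
    ultimately have "(gen a b - (\<Sum>d\<in>Z2n n. gen (hcomp d a) b))
        + ((\<Sum>d\<in>Z2n n. gen (hcomp d a) b) - ?s) \<in> S"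
      by (intro ker ker_simps(2))
    moreover have "?s \<in> S"
      by (intro free.subspace_sum S) (auto intro: gen component_in)
    ultimately have "(gen a b - (\<Sum>d\<in>Z2n n. gen (hcomp d a) b))
        + ((\<Sum>d\<in>Z2n n. gen (hcomp d a) b) - ?s) + ?s \<in> S"
      by (rule free.subspace_add[OF S])
    then show ?thesis by simp
  qed
  then have "free_lin (\<lambda>p. Poly_Mapping.single p 1) f \<in> S"
    by (intro free_lin_in S) (simp add: split_paired_all)
  then show ?thesis by (simp add: free_lin_id)
qed

lemma subspace_preimage_ker:
  fixes F :: "('a \<times> 'a \<Rightarrow>\<^sub>0 'k) \<Rightarrow> ('a \<times> 'a \<Rightarrow>\<^sub>0 'k)"
  assumes "\<And>f g. F (f + g) = F f + F g" "\<And>r f. F (free_scale r f) = free_scale r (F f)"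
  shows "free.subspace {f. F f \<in> ker}"
proof (rule free.subspaceI)
  show "0 \<in> {f. F f \<in> ker}" using assms(2)[of 0 0] by (simp add: ker_simps)
qed (simp_all add: assms ker_simps)

lemma super_mult_assoc: "smul (smul f g) h - smul f (smul g h) \<in> ker"
proof -
  let ?A = "\<lambda>f g h. smul (smul f g) h - smul f (smul g h)"
  have add: "?A (f + f') g h = ?A f g h + ?A f' g h" "?A f (g + g') h = ?A f g h + ?A f g' h"
    "?A f g (h + h') = ?A f g h + ?A f g h'" for f f' g g' h h'
    by (simp_all add: super_mult_linear_left super_mult_linear_right)
  have scale: "?A (free_scale r f) g h = free_scale r (?A f g h)"
    "?A f (free_scale r g) h = free_scale r (?A f g h)"
    "?A f g (free_scale r h) = free_scale r (?A f g h)" for r f g h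
    by (simp_all add: super_mult_linear_left super_mult_linear_right free.scale_right_diff_distrib)
  have in_ker: "f \<in> ker \<Longrightarrow> ?A f g h \<in> ker" "g \<in> ker \<Longrightarrow> ?A f g h \<in> ker"
    "h \<in> ker \<Longrightarrow> ?A f g h \<in> ker" for f g h
    by (intro ker_simps(3); blast intro: super_mult_ker_left super_mult_ker_right)+
  have hom: "?A (gen a b) (gen a' b') (gen a'' b'') \<in> ker"
    if Z: "d \<in> Z2n n" "d' \<in> Z2n n" "e' \<in> Z2n n" "e'' \<in> Z2n n"
      and G: "b \<in> G d" "a' \<in> G e'" "b' \<in> G d'" "a'' \<in> G e''"
    for d d' e' e'' a b a' b' a'' b''
  proof -
    have L: "cls (smul (smul (gen a b) (gen a' b')) (gen a'' b''))
      = cls (free_scale ((-1) ^ (rho n d * rho n e') * (-1) ^ (rho n (d + d') * rho n e''))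
          (gen (a * a' * a'') (b * b' * b'')))"
      using super_mult_cong[OF super_mult_homogeneous[OF Z(1,3) G(1,2), of a b'] refl, of "gen a'' b''"]
        cls_scale_cong[OF super_mult_homogeneous[OF Z2n_add[OF Z(1,2)] Z(4)
          mult_grade[OF Z(1,2) G(1,3)] G(4), of "a * a'" b'']]
      by (simp add: super_mult_linear_left)
    have R: "cls (smul (gen a b) (smul (gen a' b') (gen a'' b'')))
      = cls (free_scale ((-1) ^ (rho n d' * rho n e'') * (-1) ^ (rho n d * rho n (e' + e'')))
          (gen (a * (a' * a'')) (b * (b' * b''))))"
      using super_mult_cong[OF refl super_mult_homogeneous[OF Z(2,4) G(3,4), of a' b''], of "gen a b"]
        cls_scale_cong[OF super_mult_homogeneous[OF Z(1) Z2n_add[OF Z(3,4)] G(1)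
          mult_grade[OF Z(3,4) G(2,4)], of a "b' * b''"]]
      by (simp add: super_mult_linear_right)
    show ?thesis
      unfolding cls_eq_iff[symmetric] L R
      by (simp add: sign_add_left sign_add_right ac_simps)
  qed
  have h: "?A (gen a b) (gen a' b') h \<in> ker"
    if "d \<in> Z2n n" "d' \<in> Z2n n" "e' \<in> Z2n n" "b \<in> G d" "a' \<in> G e'" "b' \<in> G d'"
    for d d' e' a b a' b' h
  proof -
    have "h \<in> {h. ?A (gen a b) (gen a' b') h \<in> ker}"
      by (rule homogeneous_induct, rule subspace_preimage_ker)
        (use hom in_ker that in \<open>auto simp only: mem_Collect_eq add scale\<close>)
    then show ?thesis by simp
  qed
  have g: "?A (gen a b) g h \<in> ker" if "d \<in> Z2n n" "b \<in> G d" for d a b g h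
  proof -
    have "g \<in> {g. ?A (gen a b) g h \<in> ker}"
      by (rule homogeneous_induct, rule subspace_preimage_ker)
        (use h in_ker that in \<open>auto simp only: mem_Collect_eq add scale\<close>)
    then show ?thesis by simp
  qed
  have "f \<in> {f. ?A f g h \<in> ker}"
    by (rule homogeneous_induct, rule subspace_preimage_ker)
      (use g in_ker in \<open>auto simp only: mem_Collect_eq add scale\<close>)
  then show ?thesis by simp
qed

lemma super_mult_one: "smul (gen 1 1) f - f \<in> ker" "smul f (gen 1 1) - f \<in> ker"
proof -
  have "f \<in> {f. smul (gen 1 1) f - f \<in> ker}"
  proof (rule homogeneous_induct)
    show "free.subspace {f. smul (gen 1 1) f - f \<in> ker}"
      by (rule subspace_preimage_ker)
        (simp_all add: super_mult_linear_right free.scale_right_diff_distrib)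
  next
    fix d e a b assume "d \<in> Z2n n" "e \<in> Z2n n" "a \<in> G d" "b \<in> G e"
    then show "gen a b \<in> {f. smul (gen 1 1) f - f \<in> ker}"
      using super_mult_homogeneous[OF Z2n_zero _ one_grade, of d a 1 b]
      by (simp add: rho_zero flip: cls_eq_iff)
  qed (simp add: ker_simps super_mult_ker_right)
  then show "smul (gen 1 1) f - f \<in> ker" by simp
  have "f \<in> {f. smul f (gen 1 1) - f \<in> ker}"
  proof (rule homogeneous_induct)
    show "free.subspace {f. smul f (gen 1 1) - f \<in> ker}"
      by (rule subspace_preimage_ker)
        (simp_all add: super_mult_linear_left free.scale_right_diff_distrib)
  next
    fix d e a b assume "d \<in> Z2n n" "e \<in> Z2n n" "a \<in> G d" "b \<in> G e"
    then show "gen a b \<in> {f. smul f (gen 1 1) - f \<in> ker}"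
      using super_mult_homogeneous[OF _ Z2n_zero _ one_grade, of e b a 1]
      by (simp add: rho_zero flip: cls_eq_iff)
  qed (simp add: ker_simps super_mult_ker_left)
  then show "smul f (gen 1 1) - f \<in> ker" by simp
qed

theorem ring_super_tensor: "ring T"
proof (rule ringI)
  show "abelian_group T"
  proof (rule abelian_groupI)
    fix x assume "x \<in> carrier T"
    then obtain f where "x = cls f" by (auto simp: carrier_T)
    then have "cls (- f) \<oplus>\<^bsub>T\<^esub> x = \<zero>\<^bsub>T\<^esub>" by (simp add: add_T zero_T)
    then show "\<exists>y\<in>carrier T. y \<oplus>\<^bsub>T\<^esub> x = \<zero>\<^bsub>T\<^esub>" by (auto simp: carrier_T)
  qed (auto simp: carrier_T add_T zero_T ac_simps)
  show "monoid T"
    by (rule monoidI)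
      (auto simp only: carrier_T mult_T one_T
        super_mult_assoc[folded cls_eq_iff] super_mult_one[folded cls_eq_iff])
qed (auto simp: carrier_T add_T mult_T super_mult_linear_left super_mult_linear_right)

theorem super_tensor_algebra:
  assumes "x \<in> carrier T" "y \<in> carrier T"
  shows "r \<odot>\<^bsub>T\<^esub> x \<in> carrier T"
    and "(r + s) \<odot>\<^bsub>T\<^esub> x = r \<odot>\<^bsub>T\<^esub> x \<oplus>\<^bsub>T\<^esub> s \<odot>\<^bsub>T\<^esub> x"
    and "r \<odot>\<^bsub>T\<^esub> (x \<oplus>\<^bsub>T\<^esub> y) = r \<odot>\<^bsub>T\<^esub> x \<oplus>\<^bsub>T\<^esub> r \<odot>\<^bsub>T\<^esub> y"
    and "(r * s) \<odot>\<^bsub>T\<^esub> x = r \<odot>\<^bsub>T\<^esub> (s \<odot>\<^bsub>T\<^esub> x)"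
    and "1 \<odot>\<^bsub>T\<^esub> x = x"
    and "(r \<odot>\<^bsub>T\<^esub> x) \<otimes>\<^bsub>T\<^esub> y = r \<odot>\<^bsub>T\<^esub> (x \<otimes>\<^bsub>T\<^esub> y)"
    and "x \<otimes>\<^bsub>T\<^esub> (r \<odot>\<^bsub>T\<^esub> y) = r \<odot>\<^bsub>T\<^esub> (x \<otimes>\<^bsub>T\<^esub> y)"
  using assms
  by (auto simp: carrier_T add_T mult_T smult_T free.scale_left_distrib free.scale_right_distrib
      super_mult_linear_left super_mult_linear_right)

end

end

theory Submission
  imports Defs
begin

text \<open>
  Both sides of the module axiom are scalar multiples of \<open>a b a' b' c\<close>. Moving \<open>b\<close> past \<open>a'\<close> costs
  $(-1)^{\rho(b)\rho(a')+|b|\cdot|a'|}$; the first sign is that of the super tensor product, the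
  second comes from letting \<open>b\<close> act on \<open>a' b' c\<close>. The remaining sign $(-1)^{|b|\cdot|b'|}$ is
  absorbed by the powers of \<open>\<iota>\<close>, because over the integers
  $\rho(b+b') = \rho(b)+\rho(b')-2\,|b|\cdot|b'|$.
\<close>

section \<open>Integer and sign identities for degrees\<close>

text \<open>At an index where both bits are 1, the sum of bits is 0, so \<open>rho\<close> loses 2
  there, and \<open>dotp\<close> counts exactly these indices. The correction stands on the left to
  avoid truncated subtraction.\<close>

lemma rho_add_dotp: "rho n (d + e) + 2 * dotp n d e = rho n d + rho n e"
proof (induction n)
  case (Suc n)
  then show ?case
    by (cases "d n"; cases "e n") (auto simp: rho_def dotp_def)
qed (simp_all add: rho_def dotp_def)

lemma dotp_commute: "dotp n d e = dotp n e d"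
  by (simp add: dotp_def mult.commute)

text \<open>Bits add modulo 2, so \<open>dotp\<close> on natural numbers is additive only in parity,
  which is all that a sign detects.\<close>

lemma even_dotp_add: "even (dotp n (d + e) f) \<longleftrightarrow> even (dotp n d f + dotp n e f)"
proof (induction n)
  case (Suc n)
  then show ?case
    by (cases "d n"; cases "e n"; cases "f n") (auto simp: dotp_def)
qed (simp add: dotp_def)

lemma dotp_sign_add_left:
  "(-1) ^ dotp n (d + e) f = (-1) ^ dotp n d f * ((-1) ^ dotp n e f :: 'k::field)"
  using even_dotp_add[of n d e f] by (auto simp: minus_one_power_iff)

lemma dotp_sign_add_right:
  "(-1) ^ dotp n f (d + e) = (-1) ^ dotp n f d * ((-1) ^ dotp n f e :: 'k::field)"
  using dotp_sign_add_left[of n d e f] by (simp add: dotp_commute)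

text \<open>Powers of \<open>\<iota>\<close> depend on the exponent modulo 4, so parity is not
  enough here and the exact identity \<open>rho_add_dotp\<close> enters: each lost 2 in the exponent
  is a factor -1.\<close>

lemma root_power_rho_add:
  fixes \<iota> :: "'k::field"
  assumes "\<iota> ^ 2 = -1"
  shows "\<iota> ^ rho n d * \<iota> ^ rho n e = (-1) ^ dotp n d e * \<iota> ^ rho n (d + e)"
proof -
  have "\<iota> ^ rho n d * \<iota> ^ rho n e = \<iota> ^ rho n (d + e) * (\<iota> ^ 2) ^ dotp n d e"
    by (simp add: rho_add_dotp flip: power_add power_mult)
  then show ?thesis by (simp add: assms)
qed

text \<open>The correction term of \<open>rho_add_dotp\<close> is even and vanishes in
  \<open>bit\<close>. This makes parity a homomorphism of degrees, as the induced grading by parity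
  requires.\<close>

lemma of_nat_rho_add: "(of_nat (rho n (d + e)) :: bit) = of_nat (rho n d) + of_nat (rho n e)"
proof -
  have "(of_nat (rho n (d + e) + 2 * dotp n d e) :: bit) = of_nat (rho n d + rho n e)"
    by (simp only: rho_add_dotp)
  then show ?thesis
    by (simp only: of_nat_add of_nat_mult of_nat_numeral bit_numeral_even mult_zero_left add_0_right)
qed

section \<open>The action on representatives and its descent to the tensor product\<close>

locale braided_commutative_algebra = Z2n_graded_algebra scale n G
  for scale :: "'k::field \<Rightarrow> 'a::{ring,monoid_mult} \<Rightarrow> 'a"
    and n :: nat and G :: "(nat \<Rightarrow> bit) \<Rightarrow> 'a set" +
  fixes \<iota> :: 'k
  assumes root: "\<iota> ^ 2 = -1"
    and braided_commutative: "\<lbrakk>d \<in> Z2n n; e \<in> Z2n n; a \<in> G d; b \<in> G e\<rbrakk> \<Longrightarrow>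
      a * b = scale ((-1) ^ (rho n d * rho n e + dotp n d e)) (b * a)"
begin

text \<open>The sign and the power of \<open>\<iota>\<close> involve only the degrees of
  \<open>b\<close> and \<open>c\<close>, so this bilinear extension carries the whole twist; the
  first tensor factor then acts by plain left multiplication.\<close>

definition twisted_mult :: "'a \<Rightarrow> 'a \<Rightarrow> 'a" where
  "twisted_mult b c = (\<Sum>d\<in>Z2n n. \<Sum>e\<in>Z2n n.
     scale ((-1) ^ dotp n d e * \<iota> ^ rho n d) (hcomp d b * hcomp e c))"

definition free_act :: "('a \<times> 'a \<Rightarrow>\<^sub>0 'k) \<Rightarrow> 'a \<Rightarrow> 'a" where
  "free_act f c = (\<Sum>p\<in>Poly_Mapping.keys f.
     scale (Poly_Mapping.lookup f p) (fst p * twisted_mult (snd p) c))"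

text \<open>The choice of representative is harmless by \<open>free_act_cong\<close>.\<close>

definition tensor_act :: "('k, 'a, 'a) tensor \<Rightarrow> 'a \<Rightarrow> 'a" where
  "tensor_act X c = free_act (SOME f. f \<in> X) c"

lemma twisted_mult_linear:
  "twisted_mult (b + b') c = twisted_mult b c + twisted_mult b' c"
  "twisted_mult (scale r b) c = scale r (twisted_mult b c)"
  "twisted_mult b (c + c') = twisted_mult b c + twisted_mult b c'"
  "twisted_mult b (scale r c) = scale r (twisted_mult b c)"
  by (simp_all add: twisted_mult_def component_add component_scale distrib_left distrib_right
      scale_right_distrib sum.distrib scale_mult_left scale_mult_right scale_sum_right mult.commute)

lemma twisted_mult_homogeneous:
  assumes "d \<in> Z2n n" "e \<in> Z2n n" "b \<in> G d" "c \<in> G e"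
  shows "twisted_mult b c = scale ((-1) ^ dotp n d e * \<iota> ^ rho n d) (b * c)"
proof -
  \<comment> \<open>Only the components at \<open>d\<close> and \<open>e\<close> survive; the nested
    conditionals let both sums collapse.\<close>
  have "twisted_mult b c = (\<Sum>d'\<in>Z2n n. \<Sum>e'\<in>Z2n n. if e' = e then (if d' = d
      then scale ((-1) ^ dotp n d e * \<iota> ^ rho n d) (b * c) else 0) else 0)"
    unfolding twisted_mult_def
    by (intro sum.cong refl) (use assms in \<open>auto simp: component_homogeneous\<close>)
  then show ?thesis using assms by (simp add: finite_Z2n)
qed

lemma free_act_superset:
  assumes "finite S" "Poly_Mapping.keys f \<subseteq> S"
  shows "free_act f c
    = (\<Sum>p\<in>S. scale (Poly_Mapping.lookup f p) (fst p * twisted_mult (snd p) c))"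
  unfolding free_act_def using assms
  by (intro sum.mono_neutral_left) (auto simp: in_keys_iff)

lemma free_act_add_left: "free_act (f + g) c = free_act f c + free_act g c"
proof -
  let ?S = "Poly_Mapping.keys f \<union> Poly_Mapping.keys g"
  have "Poly_Mapping.keys (f + g) \<subseteq> ?S" by (rule keys_add)
  then show ?thesis
    by (simp add: free_act_superset[of ?S] lookup_add scale_left_distrib sum.distrib)
qed

lemma free_act_scale_left: "free_act (free_scale r f) c = scale r (free_act f c)"
proof -
  have "Poly_Mapping.keys (free_scale r f) \<subseteq> Poly_Mapping.keys f" by (auto simp: in_keys_iff)
  then show ?thesis
    by (simp add: free_act_superset[of "Poly_Mapping.keys f"] scale_sum_right)
qed

lemma free_act_linear_right:
  "free_act f (c + c') = free_act f c + free_act f c'"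
  "free_act f (scale r c) = scale r (free_act f c)"
  by (simp_all add: free_act_def twisted_mult_linear distrib_left scale_right_distrib sum.distrib
      scale_mult_right scale_sum_right mult.commute)

lemma free_act_zero: "free_act 0 c = 0"
  by (simp add: free_act_def)

lemma free_act_zero_right: "free_act f 0 = 0"
  using free_act_linear_right(1)[of f 0 0] by simp

lemma free_act_diff_left: "free_act (f - g) c = free_act f c - free_act g c"
  using free_act_add_left[of "f - g" g c] by simp

lemma free_act_gen: "free_act (gen a b) c = a * twisted_mult b c"
  by (simp add: free_act_def)

text \<open>The expression \<open>a * twisted_mult b c\<close> is bilinear in \<open>a\<close> and
  \<open>b\<close>, so each of the four families of relations acts as zero, and hence so does their
  span.\<close>

lemma free_act_ker:
  assumes "f \<in> ker"
  shows "free_act f c = 0"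
  using assms[unfolded tensor_kernel_def]
proof (induction rule: free.span_induct)
  case base
  then show ?case
    by (auto intro!: free.subspaceI simp: free_act_add_left free_act_scale_left free_act_zero)
next
  case (step f)
  then show ?case
    by (auto simp: bilinearity_relations_def free_act_diff_left free_act_scale_left free_act_gen
        twisted_mult_linear distrib_left distrib_right scale_mult_left scale_mult_right)
qed

lemma free_act_cong: "cls f = cls g \<Longrightarrow> free_act f c = free_act g c"
  using free_act_ker[of "f - g" c] by (simp add: cls_eq_iff free_act_diff_left)

lemma tensor_act_cls: "tensor_act (cls f) c = free_act f c"
proof -
  have "f \<in> cls f" by (simp add: mem_cls)
  then have "(SOME g. g \<in> cls f) \<in> cls f" by (rule someI)
  then show ?thesis
    unfolding tensor_act_def by (intro free_act_cong) (simp only: mem_cls)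
qed

section \<open>Compatibility with the super product and the unit\<close>

lemma free_act_homogeneous:
  assumes "e \<in> Z2n n" "f \<in> Z2n n" "b \<in> G e" "c \<in> G f"
  shows "free_act (gen a b) c = scale ((-1) ^ dotp n e f * \<iota> ^ rho n e) (a * b * c)"
  using assms by (simp add: free_act_gen twisted_mult_homogeneous scale_mult_right mult.assoc)

text \<open>No degree is asked of \<open>a\<close>, since it stays leftmost and is never moved past
  anything.\<close>

lemma free_act_mult_homogeneous:
  assumes Z: "e \<in> Z2n n" "d' \<in> Z2n n" "e' \<in> Z2n n" "k \<in> Z2n n"
    and G: "b \<in> G e" "a' \<in> G d'" "b' \<in> G e'" "c \<in> G k"
  shows "free_act (smul (gen a b) (gen a' b')) c = free_act (gen a b) (free_act (gen a' b') c)"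
proof -
  let ?r = "(-1) ^ (rho n e * rho n d') :: 'k"
  let ?s = "(-1) ^ dotp n (e + e') k * \<iota> ^ rho n (e + e') :: 'k"
  let ?w = "a * (b * (a' * (b' * c)))"
  have "free_act (smul (gen a b) (gen a' b')) c
      = scale ?r (free_act (gen (a * a') (b * b')) c)"
    using free_act_cong[OF super_mult_homogeneous[OF Z(1,2) G(1,2)]]
    by (simp add: free_act_scale_left)
  also have "\<dots> = scale (?r * ?s) (a * (a' * b) * (b' * c))"
    using free_act_homogeneous[OF Z2n_add[OF Z(1,3)] Z(4) mult_grade[OF Z(1,3) G(1,3)] G(4),
        of "a * a'"]
    by (simp add: mult.assoc)
  \<comment> \<open>The only use of braided commutativity: the super product has put
    \<open>a'\<close> before \<open>b\<close>, the iterated action has \<open>b\<close> before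
    \<open>a'\<close>.\<close>
  also have "a * (a' * b) * (b' * c)
      = scale ((-1) ^ (rho n d' * rho n e + dotp n d' e)) ?w"
    by (simp add: braided_commutative[OF Z(2,1) G(2,1)] scale_mult_left scale_mult_right mult.assoc)
  finally have L: "free_act (smul (gen a b) (gen a' b')) c
      = scale (?r * ?s * (-1) ^ (rho n d' * rho n e + dotp n d' e)) ?w"
    by (simp only: scale_scale)
  \<comment> \<open>This is the degree that the outer \<open>b\<close> meets, so its sign also
    involves \<open>d'\<close> and \<open>e'\<close>.\<close>
  have abc: "a' * b' * c \<in> G (d' + e' + k)"
    by (intro mult_grade Z2n_add Z G)
  have R: "free_act (gen a b) (free_act (gen a' b') c)
      = scale ((-1) ^ dotp n e' k * \<iota> ^ rho n e'
          * ((-1) ^ dotp n e (d' + e' + k) * \<iota> ^ rho n e)) ?w"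
    using free_act_homogeneous[OF Z(3,4) G(3,4), of a']
      free_act_homogeneous[OF Z(1) _ G(1) abc, of a] Z
    by (simp add: Z2n_add free_act_linear_right mult.assoc)
  \<comment> \<open>The super sign of the product cancels the super part of the braiding, leaving
    only the dot product sign.\<close>
  have rr: "?r * (-1) ^ (rho n d' * rho n e) = 1"
    by (simp add: mult.commute flip: power_add mult_2)
  have ss: "(-1) ^ dotp n e e' * (-1) ^ dotp n e e' = (1 :: 'k)"
    by (simp flip: power_add mult_2)
  have "?r * ?s * (-1) ^ (rho n d' * rho n e + dotp n d' e)
      = (?r * (-1) ^ (rho n d' * rho n e)) * (-1) ^ dotp n e d' * ?s"
    by (simp add: power_add dotp_commute[of n d' e])
  also have "\<dots> = (-1) ^ dotp n e' k * (-1) ^ dotp n e d' * (-1) ^ dotp n e k * \<iota> ^ rho n (e + e')"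
    unfolding rr by (simp add: dotp_sign_add_left)
  \<comment> \<open>A squared sign is inserted: one copy completes
    \<open>dotp n e (d' + e' + k)\<close>, the other splits the power of \<open>\<iota>\<close> by
    \<open>root_power_rho_add\<close>.\<close>
  also have "\<dots> = (-1) ^ dotp n e' k * (-1) ^ dotp n e d' * (-1) ^ dotp n e k
      * (((-1) ^ dotp n e e' * (-1) ^ dotp n e e') * \<iota> ^ rho n (e + e'))"
    unfolding ss by simp
  also have "\<dots> = (-1) ^ dotp n e' k * (-1) ^ dotp n e (d' + e' + k)
      * ((-1) ^ dotp n e e' * \<iota> ^ rho n (e + e'))"
    by (simp add: dotp_sign_add_right)
  also have "\<dots> = (-1) ^ dotp n e' k * \<iota> ^ rho n e'
      * ((-1) ^ dotp n e (d' + e' + k) * \<iota> ^ rho n e)"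
    by (simp flip: root_power_rho_add[OF root])
  finally show ?thesis by (simp add: L R)
qed

text \<open>Every element is the finite sum of its components, and additive maps commute with that
  sum. It removes the homogeneity assumption on the element acted upon.\<close>

lemma additive_eq_on_homogeneous:
  assumes "\<And>c c'. F (c + c') = F c + F c'" "\<And>c c'. H (c + c') = H c + H c'"
    and "\<And>k c. k \<in> Z2n n \<Longrightarrow> c \<in> G k \<Longrightarrow> F c = (H c :: 'b::ab_group_add)"
  shows "F c = H c"
proof -
  have zero: "F 0 = 0" "H 0 = 0"
    using assms(1)[of 0 0] assms(2)[of 0 0] by simp_all
  have "F (\<Sum>k\<in>Z2n n. hcomp k c) = (\<Sum>k\<in>Z2n n. F (hcomp k c))"
    using sum_comp_morphism[of F "\<lambda>k. hcomp k c" "Z2n n"] zero assms(1) by (simp add: o_def)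
  also have "\<dots> = (\<Sum>k\<in>Z2n n. H (hcomp k c))"
    by (intro sum.cong refl) (simp add: assms(3)[OF _ component_in])
  also have "\<dots> = H (\<Sum>k\<in>Z2n n. hcomp k c)"
    using sum_comp_morphism[of H "\<lambda>k. hcomp k c" "Z2n n"] zero assms(2) by (simp add: o_def)
  finally show ?thesis by (simp add: sum_component)
qed

text \<open>Homogeneity is dropped in turn for \<open>c\<close>, \<open>g\<close> and
  \<open>f\<close>. Kernel elements cause no trouble, because \<open>super_mult\<close> keeps them
  in the kernel, where \<open>free_act\<close> vanishes.\<close>

lemma free_act_mult: "free_act (smul f g) c = free_act f (free_act g c)"
proof -
  let ?E = "\<lambda>f g. free_act (smul f g) c = free_act f (free_act g c)"
  have smul_zero: "smul 0 g = 0" "smul g 0 = 0" for g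
    using super_mult_linear_left(3)[of n G g g g] super_mult_linear_right(3)[of n G g g g]
    by simp_all
  have subspaces: "free.subspace {f. ?E f g}" "free.subspace {g. ?E f g}" for f g
    by (auto intro!: free.subspaceI simp: smul_zero super_mult_linear_left super_mult_linear_right
        free_act_add_left free_act_scale_left free_act_linear_right free_act_zero free_act_zero_right)
  have hom: "?E (gen a b) (gen a' b')"
    if "e \<in> Z2n n" "d' \<in> Z2n n" "e' \<in> Z2n n" "b \<in> G e" "a' \<in> G d'" "b' \<in> G e'"
    for e d' e' a b a' b'
    by (rule additive_eq_on_homogeneous[where F = "free_act (smul (gen a b) (gen a' b'))"
          and H = "\<lambda>c. free_act (gen a b) (free_act (gen a' b') c)"])
      (simp_all add: free_act_linear_right free_act_mult_homogeneous[OF that(1-3) _ that(4-6)])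
  have g: "?E (gen a b) g" if "e \<in> Z2n n" "b \<in> G e" for e a b g
  proof -
    have "g \<in> {g. ?E (gen a b) g}"
      by (rule homogeneous_induct, rule subspaces)
        (use hom that in \<open>auto simp: super_mult_ker_right free_act_ker free_act_zero_right\<close>)
    then show ?thesis by simp
  qed
  have "f \<in> {f. ?E f g}"
    by (rule homogeneous_induct, rule subspaces)
      (use g in \<open>auto simp: super_mult_ker_left free_act_ker\<close>)
  then show ?thesis by simp
qed

lemma free_act_one: "free_act (gen 1 1) c = c"
  by (rule additive_eq_on_homogeneous)
    (simp_all add: free_act_linear_right free_act_homogeneous[OF Z2n_zero _ one_grade] rho_zero
      dotp_def)

lemma algebra_action_tensor_act: "algebra_action T scale tensor_act"
proof -
  have "Vector_Spaces.linear scale scale (free_act f)" for f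
    by unfold_locales (simp_all add: free_act_linear_right)
  then show ?thesis
    by (auto simp: algebra_action_def carrier_T add_T smult_T mult_T one_T tensor_act_cls[abs_def]
        free_act_add_left free_act_scale_left free_act_mult free_act_one)
qed

section \<open>Compatibility with the gradings\<close>

text \<open>Sets of degrees cover both gradings at once: singletons for the full grading, parity
  classes for the induced one. Induction over both spans reduces the claim to
  \<open>mult_grade\<close>, since the action only rescales \<open>a * b * c\<close>.\<close>

lemma tensor_act_grade_part:
  assumes h: "h \<in> tensor_part scale n G D" and c: "c \<in> grade_part scale G E"
    and E: "E \<subseteq> Z2n n" and DE: "\<And>d e. d \<in> D \<Longrightarrow> e \<in> E \<Longrightarrow> d + e \<in> F"
  shows "tensor_act h c \<in> grade_part scale G F"
proof -
  let ?S = "{gen a b | a b d e. d \<in> Z2n n \<and> e \<in> Z2n n \<and> d + e \<in> D \<and> a \<in> G d \<and> b \<in> G e}"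
  have subF: "subspace (grade_part scale G F)"
    by (simp add: grade_part_def)
  obtain f where f: "h = cls f" "f \<in> free.span ?S"
    using h by (auto simp: tensor_part_def)
  from f(2) have "free_act f c \<in> grade_part scale G F"
  proof (induction rule: free.span_induct)
    case base
    then show ?case
      using subF by (auto intro!: free.subspaceI simp: free_act_zero free_act_add_left
          free_act_scale_left subspace_0 subspace_add subspace_scale)
  next
    case (step f)
    then obtain a b d e where f: "f = gen a b" and Z: "d \<in> Z2n n" "e \<in> Z2n n" and D: "d + e \<in> D"
      and G: "a \<in> G d" "b \<in> G e" by blast
    from c[unfolded grade_part_def] show ?case
    proof (induction rule: span_induct)
      case base
      then show ?case
        using subF by (auto intro!: subspaceI simp: free_act_zero_right free_act_linear_right
            subspace_0 subspace_add subspace_scale)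
    next
      case (step c)
      then obtain k where k: "k \<in> E" "k \<in> Z2n n" "c \<in> G k" using E by auto
      have "a * b * c \<in> G (d + e + k)"
        by (intro mult_grade Z2n_add Z G k)
      then have "a * b * c \<in> grade_part scale G F"
        using DE[OF D k(1)] unfolding grade_part_def by (intro span_base) auto
      then show ?case
        by (simp add: f free_act_homogeneous[OF Z(2) k(2) G(2) k(3)] subspace_scale[OF subF])
    qed
  qed
  then show ?thesis by (simp add: f(1) tensor_act_cls)
qed

text \<open>A graded piece is a subspace and thus its own span; this turns the singleton case back
  into a statement about \<open>G\<close>.\<close>

lemma grade_part_single: "d \<in> Z2n n \<Longrightarrow> grade_part scale G {d} = G d"
  by (simp add: grade_part_def subspace_grade)

end

theorem proposition4p1:
  fixes scale :: "'k::field \<Rightarrow> 'a::{ring,monoid_mult} \<Rightarrow> 'a"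
    and n :: nat
    and G :: "(nat \<Rightarrow> bit) \<Rightarrow> 'a set"
    and \<iota> :: 'k
  assumes char: "CHAR('k) \<noteq> 2"
    and root: "\<iota> ^ 2 = -1"
    and graded: "Z2n_graded_algebra scale n G"
    and braided_commutative:
      "\<And>d e a b. \<lbrakk>d \<in> Z2n n; e \<in> Z2n n; a \<in> G d; b \<in> G e\<rbrakk> \<Longrightarrow>
         a * b = scale ((-1) ^ (rho n d * rho n e + dotp n d e)) (b * a)"
  shows "\<exists>act. algebra_action (super_tensor scale n G) scale act \<and>
    (\<forall>d\<in>Z2n n. \<forall>e\<in>Z2n n. \<forall>f\<in>Z2n n. \<forall>a\<in>G d. \<forall>b\<in>G e. \<forall>c\<in>G f.
       act (pure_tensor scale scale a b) c
         = scale ((-1) ^ dotp n e f * \<iota> ^ rho n e) (a * b * c)) \<and>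
    (\<forall>d\<in>Z2n n. \<forall>e\<in>Z2n n. \<forall>h\<in>tensor_part scale n G {d}. \<forall>c\<in>G e.
       act h c \<in> G (d + e)) \<and>
    (\<forall>p q :: bit.
       \<forall>h\<in>tensor_part scale n G {d \<in> Z2n n. of_nat (rho n d) = p}.
       \<forall>c\<in>grade_part scale G {d \<in> Z2n n. of_nat (rho n d) = q}.
       act h c \<in> grade_part scale G {d \<in> Z2n n. of_nat (rho n d) = p + q})"
proof -
  interpret braided_commutative_algebra scale n G \<iota>
    by (intro braided_commutative_algebra.intro braided_commutative_algebra_axioms.intro
        graded root braided_commutative)
  show ?thesis
  proof (intro exI conjI ballI allI)
    show "algebra_action T scale tensor_act" by (rule algebra_action_tensor_act)
  next
    fix d e f a b c
    assume "d \<in> Z2n n" "e \<in> Z2n n" "f \<in> Z2n n" "a \<in> G d" "b \<in> G e" "c \<in> G f"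
    then show "tensor_act (pure_tensor scale scale a b) c
        = scale ((-1) ^ dotp n e f * \<iota> ^ rho n e) (a * b * c)"
      by (simp add: pure_tensor_def tensor_act_cls free_act_homogeneous)
  next
    fix d e h c
    assume "d \<in> Z2n n" "e \<in> Z2n n" "h \<in> tensor_part scale n G {d}" "c \<in> G e"
    then show "tensor_act h c \<in> G (d + e)"
      using tensor_act_grade_part[of h "{d}" c "{e}" "{d + e}"]
      by (simp add: grade_part_single Z2n_add)
  next
    fix p q :: bit and h c
    assume "h \<in> tensor_part scale n G {d \<in> Z2n n. of_nat (rho n d) = p}"
      and "c \<in> grade_part scale G {d \<in> Z2n n. of_nat (rho n d) = q}"
    then show "tensor_act h c \<in> grade_part scale G {d \<in> Z2n n. of_nat (rho n d) = p + q}"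
      by (rule tensor_act_grade_part) (auto simp: Z2n_add of_nat_rho_add)
  qed
qed

end
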